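(* Let $k,r\in\mathbb{N}$, let $z=z(t)$ and $z_0=z_0(t)$ be meromorphic functions with at most logarithmic singularities, and let $x>0$ be such that all integrals below converge absolutely. Then $$\sum_{\substack{k_1+\cdots+k_r=k+r-1\\ k_1,\ldots,k_r\ge1}}L_{z_0}\left(\begin{array}{c}\{z\}_r\\ k_1,\ldots,k_r\end{array};x\right)=\sum_{j=1}^r(-1)^{j-1}L_{z_0}\left(\begin{array}{c}\{z\}_{r-j}\\ \{1\}_{r-j}\end{array};x\right)L_{z_0}\left(\begin{array}{c}\{z\}_j\\ \{1\}_{j-1},k\end{array};x\right)$$ and $$L_{z_0}\left(\begin{array}{c}\{z\}_r\\ \{1\}_{r-1},k\end{array};x\right)=\sum_{j=1}^r(-1)^{j-1}L_{z_0}\left(\begin{array}{c}\{z\}_{r-j}\\ \{1\}_{r-j}\end{array};x\right)\sum_{\substack{k_1+\cdots+k_j=k+j-1\\ k_1,\ldots,k_j\ge1}}L_{z_0}\left(\begin{array}{c}\{z\}_j\\ k_1,\ldots,k_j\end{array};x\right).$$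
   Context: $\mathbb{N}$ is the set of positive integers. $\{a\}_n$ means $a$ repeated $n$ times (nothing if $n=0$). "At most logarithmic singularities" means that the poles of the function are at most simple. Iterated integral: $\int_0^x f_1(t)dt\,f_2(t)dt\cdots f_n(t)dt:=\int_{0<t_1<\cdots<t_n<x}f_1(t_1)\cdots f_n(t_n)\,dt_1\cdots dt_n$. Formal multiple polylogarithm function: for functions $w_1,\ldots,w_d$ and positive integers $m_1,\ldots,m_d$, $$L_{z_0}\left(\begin{array}{c}w_1,\ldots,w_d\\ m_1,\ldots,m_d\end{array};x\right):=\int_0^x w_1(t)dt\,(z_0(t)dt)^{m_1-1}\cdots w_d(t)dt\,(z_0(t)dt)^{m_d-1},$$ where $(z_0(t)dt)^{m}$ denotes $m$ consecutive factors $z_0(t)dt$; for $d=0$ the value is $1$. *)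

theory Defs
  imports "HOL-Complex_Analysis.Complex_Analysis" "HOL-Analysis.Analysis"
begin

text \<open>
  The library's \<open>meromorphic_on\<close> leaves the values on a discrete set arbitrary (in particular
  the values at poles); this does not affect the integrals below.
\<close>

definition at_most_log_singularities_on :: "(complex \<Rightarrow> complex) \<Rightarrow> complex set \<Rightarrow> bool" where
  "at_most_log_singularities_on f D \<longleftrightarrow>
     f meromorphic_on D \<and> (\<forall>p\<in>D. is_pole f p \<longrightarrow> zorder f p \<ge> -1)"

text \<open>
  Points of \<open>\<real>\<^sup>n\<close> are functions in \<open>{..<n} \<rightarrow>\<^sub>E UNIV\<close>, so the coordinates
  $t_1, \ldots, t_n$ are \<open>t 0, \<dots>, t (n - 1)\<close>.
\<close>

definition lborel_pow :: "nat \<Rightarrow> (nat \<Rightarrow> real) measure" where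
  "lborel_pow n = PiM {..<n} (\<lambda>_. lborel)"

definition open_simplex :: "nat \<Rightarrow> real \<Rightarrow> (nat \<Rightarrow> real) set" where
  "open_simplex n x =
     {t \<in> space (lborel_pow n). (\<forall>i<n. 0 < t i \<and> t i < x) \<and> (\<forall>i j. i < j \<and> j < n \<longrightarrow> t i < t j)}"

definition iterated_integrand :: "(complex \<Rightarrow> complex) list \<Rightarrow> (nat \<Rightarrow> real) \<Rightarrow> complex" where
  "iterated_integrand fs t = (\<Prod>i<length fs. (fs ! i) (complex_of_real (t i)))"

definition iterated_integral :: "(complex \<Rightarrow> complex) list \<Rightarrow> real \<Rightarrow> complex" where
  "iterated_integral fs x =
     (LINT t:open_simplex (length fs) x|lborel_pow (length fs). iterated_integrand fs t)"

definition iterated_integral_converges :: "(complex \<Rightarrow> complex) list \<Rightarrow> real \<Rightarrow> bool" where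
  "iterated_integral_converges fs x \<longleftrightarrow>
     set_integrable (lborel_pow (length fs)) (open_simplex (length fs) x) (iterated_integrand fs)"

lemma iterated_integral_Nil: "iterated_integral [] x = 1"
  by (simp add: iterated_integral_def iterated_integrand_def open_simplex_def lborel_pow_def
      set_lebesgue_integral_def PiM_empty lebesgue_integral_count_space_finite)

definition polylog_word ::
    "(complex \<Rightarrow> complex) \<Rightarrow> (complex \<Rightarrow> complex) list \<Rightarrow> nat list \<Rightarrow> (complex \<Rightarrow> complex) list" where
  "polylog_word z0 ws ms = concat (map2 (\<lambda>w m. w # replicate (m - 1) z0) ws ms)"

definition formal_polylog ::
    "(complex \<Rightarrow> complex) \<Rightarrow> (complex \<Rightarrow> complex) list \<Rightarrow> nat list \<Rightarrow> real \<Rightarrow> complex" where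
  "formal_polylog z0 ws ms x = iterated_integral (polylog_word z0 ws ms) x"

definition formal_polylog_converges ::
    "(complex \<Rightarrow> complex) \<Rightarrow> (complex \<Rightarrow> complex) list \<Rightarrow> nat list \<Rightarrow> real \<Rightarrow> bool" where
  "formal_polylog_converges z0 ws ms x \<longleftrightarrow> iterated_integral_converges (polylog_word z0 ws ms) x"

lemma formal_polylog_Nil: "formal_polylog z0 [] [] x = 1"
  by (simp add: formal_polylog_def polylog_word_def iterated_integral_Nil)

definition compositions :: "nat \<Rightarrow> nat \<Rightarrow> nat list set" where
  "compositions d n = {ks. length ks = d \<and> (\<forall>m\<in>set ks. m \<ge> 1) \<and> sum_list ks = n}"

lemma finite_compositions: "finite (compositions d n)"
proof (rule finite_subset)
  show "compositions d n \<subseteq> {ks. set ks \<subseteq> {..n} \<and> length ks = d}"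
    by (auto simp: compositions_def intro: member_le_sum_list)
qed (rule finite_lists_length_eq, simp)

end

theory Submission
  imports Defs
begin

text \<open>
  Iterated integrals satisfy the shuffle product formula: the product of two of them is the sum over
  all shuffles of the two words. Write \<open>S n\<close> for the sum over compositions, \<open>F n\<close> for the integral
  of the word $z^n$ and \<open>T n\<close> for that of $z^n z_0^{k-1}$. The words in \<open>S n\<close> are exactly the letter
  $z$ followed by a shuffle of $z^{n-1}$ and $z_0^{k-1}$. Splitting the shuffles of $z^{n-j}$ and
  $z^j z_0^{k-1}$ by the origin of the first letter makes the alternating sum over \<open>j\<close> telescope to
  \<open>S n\<close>, which is the first identity. For $k = 1$ it says that $\sum_j (-1)^j F_{n-j} F_j$ vanishes for
  $n \ge 1$, so that the first identity can be inverted; this gives the second one.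
\<close>

section \<open>Shuffles of words\<close>

text \<open>The obstacle is convergence. The shuffle formula cuts a product of two integrals
  according to which of the two smallest variables comes first. This needs Fubini's theorem, hence
  absolute convergence of the words produced. The formula is therefore proved twice along the same
  recursion: for the integrals of absolute values, as an identity in [0, \<infinity>] that asks for
  no convergence, and then for the complex integrals. The first version shows that all shuffles of
  two absolutely convergent words converge absolutely, which licenses the second.

  The inversion has a similar constraint. The word z^n is assumed to converge for n < r only;
  already for r = 1 and k = 2 the word z^r may diverge. So the inversion is a finite argument in
  which \<open>F r\<close> never occurs, not an identity between full generating functions.\<close>

text \<open>A list of words, not a set as in the library's \<open>shuffles\<close>, because multiplicities matter.\<close>

fun shuffle_list :: "'a list \<Rightarrow> 'a list \<Rightarrow> 'a list list" where
  "shuffle_list [] ys = [ys]"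
| "shuffle_list (x # xs) [] = [x # xs]"
| "shuffle_list (x # xs) (y # ys) =
     map ((#) x) (shuffle_list xs (y # ys)) @ map ((#) y) (shuffle_list (x # xs) ys)"

lemma shuffle_list_Nil_right [simp]: "shuffle_list xs [] = [xs]"
  by (cases xs) auto

lemma set_shuffle_list: "w \<in> set (shuffle_list u v) \<Longrightarrow> set w = set u \<union> set v"
  by (induction u v arbitrary: w rule: shuffle_list.induct) auto

text \<open>Both words can only supply the letter \<open>a\<close> first, so the two branches of
  neighbouring terms coincide and cancel. What survives is the branch of the term
  \<open>j = 1\<close> in which the second word gives up its only leading \<open>a\<close>.\<close>

lemma alternating_shuffle_sum:
  fixes \<phi> :: "'a list \<Rightarrow> 'b::comm_ring_1"
  shows "(\<Sum>j=1..Suc r. (-1) ^ (j - 1) *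
             sum_list (map \<phi> (shuffle_list (replicate (Suc r - j) a) (replicate j a @ v)))) =
         sum_list (map (\<lambda>w. \<phi> (a # w)) (shuffle_list (replicate r a) v))"
proof -
  define p where "p i = sum_list (map (\<lambda>w. \<phi> (a # w))
      (shuffle_list (replicate (r - i) a) (replicate i a @ v)))" for i
  \<comment> \<open>Here \<open>j = Suc i\<close>. Taking the first letter from the second word
    leaves \<open>p i\<close>, taking it from the first leaves \<open>p (Suc i)\<close>. For
    \<open>i = r\<close> the first word is empty and the latter branch is missing; the
    \<open>if\<close> records this, since truncated subtraction would make \<open>p (Suc r)\<close>
    a spurious boundary term.\<close>
  have split: "sum_list (map \<phi> (shuffle_list (replicate (Suc r - Suc i) a) (replicate (Suc i) a @ v)))
      = p i + (if i < r then p (Suc i) else 0)" if "i \<le> r" for i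
  proof (cases "i < r")
    case True
    then obtain m where "r - i = Suc m"
      by (metis Suc_diff_Suc)
    moreover from this have "r - Suc i = m"
      by simp
    ultimately show ?thesis
      using True by (simp add: p_def comp_def add.commute)
  next
    case False
    with that show ?thesis
      by (simp add: p_def)
  qed
  have telescope: "(\<Sum>i\<le>n. (-1) ^ i * (p i + p (Suc i))) = p 0 + (-1) ^ n * p (Suc n)" for n
    by (induction n) (simp_all add: distrib_left)
  have "(\<Sum>j=1..Suc r. (-1) ^ (j - 1) *
             sum_list (map \<phi> (shuffle_list (replicate (Suc r - j) a) (replicate j a @ v))))
      = (\<Sum>i=0..r. (-1) ^ i * (p i + (if i < r then p (Suc i) else 0)))"
    unfolding One_nat_def sum.shift_bounds_cl_Suc_ivl
  proof (intro sum.cong refl)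
    fix i assume "i \<in> {0..r}"
    then show "(-1) ^ (Suc i - Suc 0) *
          sum_list (map \<phi> (shuffle_list (replicate (Suc r - Suc i) a) (replicate (Suc i) a @ v))) =
        (-1) ^ i * (p i + (if i < r then p (Suc i) else 0))"
      by (subst split) simp_all
  qed
  also have "\<dots> = p 0"
  proof (cases r)
    case (Suc n)
    have "(\<Sum>i\<le>n. (-1) ^ i * (p i + (if i < r then p (Suc i) else 0))) =
        (\<Sum>i\<le>n. (-1) ^ i * (p i + p (Suc i)))"
      using Suc by (intro sum.cong) auto
    then show ?thesis
      using Suc telescope[of n] by (simp add: atLeast0AtMost)
  qed simp
  finally show ?thesis
    by (simp add: p_def)
qed

section \<open>Compositions\<close>

lemma compositions_1: "n \<ge> 1 \<Longrightarrow> compositions (Suc 0) n = {[n]}"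
  by (auto simp: compositions_def length_Suc_conv)

lemma compositions_less:
  assumes "n < d"
  shows "compositions d n = {}"
proof -
  have "length ks \<le> sum_list ks" if "\<forall>m\<in>set ks. m \<ge> 1" for ks :: "nat list"
    using that by (induction ks) auto
  then have "ks \<notin> compositions d n" for ks
    using assms unfolding compositions_def mem_Collect_eq by (metis not_le)
  then show ?thesis
    by blast
qed

text \<open>The first part is either 1 or can be lowered by one. In the associated word this decides
  whether the leading \<open>z\<close> is followed by another \<open>z\<close> or by
  \<open>z0\<close>, so the split matches the two branches of \<open>shuffle_list\<close>.\<close>

lemma compositions_Suc:
  "compositions (Suc d) (Suc n) =
     (#) 1 ` compositions d n \<union> (\<lambda>ks. Suc (hd ks) # tl ks) ` compositions (Suc d) n"
    (is "?L = ?R")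
proof
  show "?R \<subseteq> ?L"
    by (auto simp: compositions_def length_Suc_conv)
  show "?L \<subseteq> ?R"
  proof
    fix ks assume ks: "ks \<in> ?L"
    then obtain m ms where [simp]: "ks = m # ms" and m: "m \<ge> 1" "length ms = d"
        "\<forall>m\<in>set ms. m \<ge> 1" "m + sum_list ms = Suc n"
      by (auto simp: compositions_def length_Suc_conv)
    show "ks \<in> ?R"
    proof (cases "m = 1")
      case False
      with m have "(m - 1) # ms \<in> compositions (Suc d) n"
        by (auto simp: compositions_def)
      moreover from m have "ks = Suc (hd ((m - 1) # ms)) # tl ((m - 1) # ms)"
        by simp
      ultimately show ?thesis by blast
    qed (use m in \<open>auto simp: compositions_def\<close>)
  qed
qed

lemma sum_compositions_Suc:
  "(\<Sum>ks\<in>compositions (Suc d) (Suc n). g ks) =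
     (\<Sum>ks\<in>compositions d n. g (1 # ks)) +
     (\<Sum>ks\<in>compositions (Suc d) n. g (Suc (hd ks) # tl ks))"
proof -
  let ?A = "(#) 1 ` compositions d n"
  let ?B = "(\<lambda>ks. Suc (hd ks) # tl ks) ` compositions (Suc d) n"
  have nonempty: "ks \<noteq> [] \<and> hd ks \<ge> 1" if "ks \<in> compositions (Suc d) n" for ks
    using that by (cases ks) (simp_all add: compositions_def)
  \<comment> \<open>A head that is at least 1 becomes at least 2, so it cannot equal the head 1 of
    the other family.\<close>
  have "?A \<inter> ?B = {}"
    using nonempty by fastforce
  then have "(\<Sum>ks\<in>compositions (Suc d) (Suc n). g ks) = sum g ?A + sum g ?B"
    unfolding compositions_Suc by (intro sum.union_disjoint) (simp_all add: finite_compositions)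
  moreover have "sum g ?A = (\<Sum>ks\<in>compositions d n. g (1 # ks))"
    by (simp add: sum.reindex)
  moreover have "inj_on (\<lambda>ks. Suc (hd ks) # tl ks) (compositions (Suc d) n)"
    by (rule inj_onI) (use nonempty list.expand in blast)
  then have "sum g ?B = (\<Sum>ks\<in>compositions (Suc d) n. g (Suc (hd ks) # tl ks))"
    by (simp add: sum.reindex)
  ultimately show ?thesis
    by simp
qed

section \<open>Words of polylogarithms, and compositions as shuffles\<close>

lemma polylog_word_Cons:
  "polylog_word z0 (w # ws) (m # ms) = w # replicate (m - 1) z0 @ polylog_word z0 ws ms"
  by (simp add: polylog_word_def)

lemma polylog_word_Nil: "polylog_word z0 [] [] = []"
  by (simp add: polylog_word_def)

lemma polylog_word_ones: "polylog_word z0 (replicate n z) (replicate n 1) = replicate n z"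
  by (induction n) (simp_all add: polylog_word_Nil polylog_word_Cons)

lemma polylog_word_ones_snoc:
  "j \<ge> 1 \<Longrightarrow> polylog_word z0 (replicate j z) (replicate (j - 1) 1 @ [k]) =
     replicate j z @ replicate (k - 1) z0"
proof (induction j rule: nat_induct_at_least)
  case base
  then show ?case by (simp add: polylog_word_def)
next
  case (Suc n)
  then have "replicate (Suc n - 1) 1 @ [k] = 1 # replicate (n - 1) 1 @ [k]"
    by (cases n) auto
  with Suc show ?case by (simp add: polylog_word_Cons)
qed

text \<open>A composition records how \<open>l\<close> letters \<open>z0\<close> are distributed
  over the gaps after \<open>Suc r\<close> letters \<open>z\<close>, the first of which is fixed; a
  shuffle records the same choice. Summing over compositions and over a list counts choices and not
  words, so the identity also covers \<open>z = z0\<close>. The map \<phi> is arbitrary because the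
  induction absorbs prefixes into it.\<close>

lemma sum_compositions_polylog_word:
  fixes \<phi> :: "(complex \<Rightarrow> complex) list \<Rightarrow> 'b::comm_monoid_add"
  shows "(\<Sum>ks\<in>compositions (Suc r) (Suc r + l). \<phi> (polylog_word z0 (replicate (Suc r) z) ks)) =
     sum_list (map (\<lambda>w. \<phi> (z # w)) (shuffle_list (replicate r z) (replicate l z0)))"
proof (induction "r + l" arbitrary: r l \<phi>)
  case 0
  then show ?case
    by (simp add: compositions_1 polylog_word_Cons polylog_word_Nil)
next
  case (Suc n)
  note IH = Suc.hyps(1)
  show ?case
  proof (cases "r = 0")
    case True
    then show ?thesis
      by (simp add: compositions_1 polylog_word_Cons polylog_word_Nil)
  next
    case False
    then obtain r' where r: "r = Suc r'"
      by (cases r) auto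
    have ones: "(\<Sum>ks\<in>compositions r (r + l). \<phi> (polylog_word z0 (replicate (Suc r) z) (1 # ks))) =
        sum_list (map (\<lambda>w. \<phi> (z # z # w)) (shuffle_list (replicate r' z) (replicate l z0)))"
      using IH[of r' l "\<lambda>w. \<phi> (z # w)"] Suc(2) r by (simp add: polylog_word_Cons)
    show ?thesis
    proof (cases l)
      case 0
      \<comment> \<open>Without any \<open>z0\<close> to place all parts equal 1, so the sum over
        larger first parts is empty.\<close>
      then show ?thesis
        using ones r by (simp add: sum_compositions_Suc[where d = "Suc r'"] compositions_less)
    next
      case (Suc l')
      \<comment> \<open>Raising the first part by one inserts \<open>z0\<close> right after the
        leading \<open>z\<close>. Written as the operation \<open>z # z0 # tl w\<close> on words, it
        can be merged into \<phi> before the induction hypothesis is applied.\<close>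
      have "(\<Sum>ks\<in>compositions (Suc r) (r + l).
            \<phi> (polylog_word z0 (replicate (Suc r) z) (Suc (hd ks) # tl ks))) =
          (\<Sum>ks\<in>compositions (Suc r) (Suc r + l').
            \<phi> (z # z0 # tl (polylog_word z0 (replicate (Suc r) z) ks)))"
      proof (intro sum.cong)
        fix ks assume "ks \<in> compositions (Suc r) (Suc r + l')"
        then obtain m ms where "ks = Suc m # ms"
          by (auto simp: compositions_def length_Suc_conv Suc_le_eq gr0_conv_Suc)
        then show "\<phi> (polylog_word z0 (replicate (Suc r) z) (Suc (hd ks) # tl ks)) =
            \<phi> (z # z0 # tl (polylog_word z0 (replicate (Suc r) z) ks))"
          by (simp add: polylog_word_Cons)
      qed (simp add: Suc)
      also have "\<dots> = sum_list (map (\<lambda>w. \<phi> (z # z0 # w)) (shuffle_list (replicate r z) (replicate l' z0)))"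
        using \<open>Suc n = r + l\<close> \<open>l = Suc l'\<close> IH[of r l' "\<lambda>w. \<phi> (z # z0 # tl w)"] by simp
      finally show ?thesis
        using ones r Suc by (simp add: sum_compositions_Suc[where d = "Suc r'"] comp_def)
    qed
  qed
qed

section \<open>Inverting an alternating convolution\<close>

text \<open>Put G n = (-1)^n F n. By \<open>FF\<close>, the convolution of F and G is the unit
  sequence below index r. The hypothesis \<open>S\<close> says that (-1)^(j-1) S j is the
  convolution of G and T, and convolving once more with F returns T. Since T starts at index 1, only
  the entries r - i < r of F * G are met, so \<open>FF\<close> is required for n < r only.\<close>

lemma alternating_convolution_inversion:
  fixes F S T :: "nat \<Rightarrow> 'a::comm_ring_1"
  assumes "r \<ge> 1" and F0: "F 0 = 1"
    and FF: "\<And>n. 1 \<le> n \<Longrightarrow> n < r \<Longrightarrow> F n = (\<Sum>j=1..n. (-1) ^ (j - 1) * F (n - j) * F j)"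
    and S: "\<And>n. 1 \<le> n \<Longrightarrow> n \<le> r \<Longrightarrow> S n = (\<Sum>j=1..n. (-1) ^ (j - 1) * F (n - j) * T j)"
  shows "T r = (\<Sum>j=1..r. (-1) ^ (j - 1) * F (r - j) * S j)"
proof -
  \<comment> \<open>\<open>FF\<close> in symmetric form: its left side becomes the term
    \<open>j = 0\<close>.\<close>
  have orth: "(\<Sum>j=0..n. (-1) ^ j * F (n - j) * F j) = (if n = 0 then 1 else 0)" if "n < r" for n
  proof (cases "n = 0")
    case False
    then have "(\<Sum>j=0..n. (-1) ^ j * F (n - j) * F j) =
        F n + (\<Sum>j=1..n. (-1) ^ j * F (n - j) * F j)"
      by (simp add: sum.atLeast_Suc_atMost F0)
    also have "(\<Sum>j=1..n. (-1) ^ j * F (n - j) * F j) =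
        - (\<Sum>j=1..n. (-1) ^ (j - 1) * F (n - j) * F j)"
      unfolding sum_negf[symmetric]
    proof (intro sum.cong refl)
      fix j assume "j \<in> {1..n}"
      then obtain i where "j = Suc i" by (cases j) auto
      then show "(-1) ^ j * F (n - j) * F j = - ((-1) ^ (j - 1) * F (n - j) * F j)" by simp
    qed
    finally show ?thesis using FF[of n] False that by simp
  qed (simp add: F0)
  have "(\<Sum>j=1..r. (-1) ^ (j - 1) * F (r - j) * S j) =
      (\<Sum>j=1..r. \<Sum>i=1..j. (-1) ^ (j - 1) * F (r - j) * ((-1) ^ (i - 1) * F (j - i) * T i))"
    by (intro sum.cong refl) (simp add: S sum_distrib_left)
  also have "\<dots> = (\<Sum>i=1..r. \<Sum>j=i..r. (-1) ^ (j - 1) * F (r - j) * ((-1) ^ (i - 1) * F (j - i) * T i))"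
    unfolding sum.Sigma[OF finite_atLeastAtMost ballI[OF finite_atLeastAtMost]]
    by (rule sum.reindex_bij_witness[of _ "\<lambda>(i, j). (j, i)" "\<lambda>(i, j). (j, i)"]) auto
  \<comment> \<open>Substitute m = j - i. The signs combine to (-1)^m because the exponents j - 1
    and i - 1 differ by m.\<close>
  also have "\<dots> = (\<Sum>i=1..r. T i * (\<Sum>m=0..r - i. (-1) ^ m * F (r - i - m) * F m))"
  proof (intro sum.cong refl)
    fix i assume i: "i \<in> {1..r}"
    have "(\<Sum>j=i..r. (-1) ^ (j - 1) * F (r - j) * ((-1) ^ (i - 1) * F (j - i) * T i)) =
        (\<Sum>m=0..r - i. (-1) ^ (m + i - 1) * F (r - i - m) * ((-1) ^ (i - 1) * F m * T i))"
      using i by (intro sum.reindex_bij_witness[of _ "\<lambda>m. m + i" "\<lambda>j. j - i"]) auto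
    also have "\<dots> = (\<Sum>m=0..r - i. T i * ((-1) ^ m * F (r - i - m) * F m))"
    proof (intro sum.cong refl)
      fix m
      obtain i' where "i = Suc i'" using i by (cases i) auto
      then have sign: "(-1) ^ (m + i - 1) * (-1) ^ (i - 1) = ((-1) ^ m :: 'a)"
        by (simp add: power_add mult.assoc)
      have "(-1) ^ (m + i - 1) * F (r - i - m) * ((-1) ^ (i - 1) * F m * T i) =
          ((-1) ^ (m + i - 1) * (-1) ^ (i - 1)) * (T i * (F (r - i - m) * F m))"
        by (simp only: ac_simps)
      also have "\<dots> = T i * ((-1) ^ m * F (r - i - m) * F m)"
        unfolding sign by (simp only: ac_simps)
      finally show "(-1) ^ (m + i - 1) * F (r - i - m) * ((-1) ^ (i - 1) * F m * T i) =
          T i * ((-1) ^ m * F (r - i - m) * F m)" .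
    qed
    finally show "(\<Sum>j=i..r. (-1) ^ (j - 1) * F (r - j) * ((-1) ^ (i - 1) * F (j - i) * T i)) =
        T i * (\<Sum>m=0..r - i. (-1) ^ m * F (r - i - m) * F m)"
      by (simp add: sum_distrib_left)
  qed
  also have "\<dots> = (\<Sum>i=1..r. if i = r then T i else 0)"
  proof (intro sum.cong refl)
    fix i assume "i \<in> {1..r}"
    then have "(\<Sum>m=0..r - i. (-1) ^ m * F (r - i - m) * F m) = (if r - i = 0 then 1 else 0)"
      by (intro orth) auto
    with \<open>i \<in> {1..r}\<close> show "T i * (\<Sum>m=0..r - i. (-1) ^ m * F (r - i - m) * F m) =
        (if i = r then T i else 0)"
      by (simp only:) auto
  qed
  also have "\<dots> = T r"
    using \<open>r \<ge> 1\<close> by simp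
  finally show ?thesis ..
qed

section \<open>Iterated integrals over the simplex\<close>

lemma sigma_finite_lborel_pow: "sigma_finite_measure (lborel_pow n)"
proof -
  interpret product_sigma_finite "\<lambda>_::nat. lborel :: real measure" ..
  show ?thesis unfolding lborel_pow_def by (rule sigma_finite) simp
qed

lemma space_lborel_pow: "space (lborel_pow n) = {..<n} \<rightarrow>\<^sub>E UNIV"
  by (simp add: lborel_pow_def space_PiM)

lemma measurable_case_nat_lborel_pow:
  "(\<lambda>(a, \<omega>). case_nat a \<omega>) \<in> lborel \<Otimes>\<^sub>M lborel_pow n \<rightarrow>\<^sub>M lborel_pow (Suc n)"
proof -
  have "(\<lambda>p i. case_nat (fst p) (snd p) i) \<in> lborel \<Otimes>\<^sub>M lborel_pow n \<rightarrow>\<^sub>M PiM {..<Suc n} (\<lambda>_. lborel)"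
  proof (rule measurable_PiM_single')
    fix i assume "i \<in> {..<Suc n}"
    then show "(\<lambda>p. case_nat (fst p) (snd p) i) \<in> lborel \<Otimes>\<^sub>M lborel_pow n \<rightarrow>\<^sub>M lborel"
      unfolding lborel_pow_def by (cases i) auto
  next
    show "(\<lambda>p i. case_nat (fst p) (snd p) i) \<in>
        space (lborel \<Otimes>\<^sub>M lborel_pow n) \<rightarrow> (\<Pi>\<^sub>E i\<in>{..<Suc n}. space lborel)"
      by (auto simp: space_pair_measure space_lborel_pow PiE_iff extensional_def split: nat.splits)
  qed
  then show ?thesis
    by (simp add: lborel_pow_def case_prod_beta')
qed

text \<open>Splits off the first coordinate and renumbers the others from 0, so that the tail of a
  word is again integrated over \<open>lborel_pow n\<close>. Product measures are determined by
  their values on boxes, and the preimage of a box under \<open>case_nat\<close> is a product of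
  boxes.\<close>

lemma lborel_pow_Suc:
  "lborel_pow (Suc n) =
     distr (lborel \<Otimes>\<^sub>M lborel_pow n) (lborel_pow (Suc n)) (\<lambda>(a, \<omega>). case_nat a \<omega>)"
proof -
  interpret P: product_sigma_finite "\<lambda>_::nat. lborel :: real measure" ..
  interpret S: sigma_finite_measure "lborel_pow n" by (rule sigma_finite_lborel_pow)
  have "distr (lborel \<Otimes>\<^sub>M lborel_pow n) (lborel_pow (Suc n)) (\<lambda>(a, \<omega>). case_nat a \<omega>) =
      PiM {..<Suc n} (\<lambda>_. lborel)"
  proof (rule P.PiM_eqI)
    fix A :: "nat \<Rightarrow> real set"
    assume A: "\<And>i. i \<in> {..<Suc n} \<Longrightarrow> A i \<in> sets lborel"
    have box: "Pi\<^sub>E {..<Suc n} A \<in> sets (lborel_pow (Suc n))"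
      unfolding lborel_pow_def using A by (intro sets_PiM_I_finite) auto
    have box': "Pi\<^sub>E {..<n} (\<lambda>i. A (Suc i)) \<in> sets (lborel_pow n)"
      unfolding lborel_pow_def using A by (intro sets_PiM_I_finite) auto
    have "(\<lambda>(a, \<omega>). case_nat a \<omega>) -` Pi\<^sub>E {..<Suc n} A \<inter> space (lborel \<Otimes>\<^sub>M lborel_pow n) =
        A 0 \<times> Pi\<^sub>E {..<n} (\<lambda>i. A (Suc i))"
    proof -
      \<comment> \<open>Extensionality of \<omega> beyond n passes to
        \<open>case_nat a \<omega>\<close> beyond \<open>Suc n\<close>, so only the coordinates have
        to be compared.\<close>
      have "case_nat a \<omega> \<in> Pi\<^sub>E {..<Suc n} A \<longleftrightarrow> a \<in> A 0 \<and> \<omega> \<in> Pi\<^sub>E {..<n} (\<lambda>i. A (Suc i))"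
        if "\<omega> \<in> {..<n} \<rightarrow>\<^sub>E UNIV" for a \<omega>
      proof -
        have "case_nat a \<omega> \<in> Pi\<^sub>E {..<Suc n} A \<longleftrightarrow> (\<forall>i<Suc n. case_nat a \<omega> i \<in> A i)"
          using that by (auto simp: PiE_iff extensional_def split: nat.split)
        also have "\<dots> \<longleftrightarrow> a \<in> A 0 \<and> (\<forall>i<n. \<omega> i \<in> A (Suc i))"
          by (simp add: All_less_Suc2)
        finally show ?thesis
          using that by (auto simp: PiE_iff)
      qed
      then show ?thesis
        by (auto simp: space_pair_measure space_lborel_pow PiE_iff)
    qed
    then have "emeasure (distr (lborel \<Otimes>\<^sub>M lborel_pow n) (lborel_pow (Suc n)) (\<lambda>(a, \<omega>). case_nat a \<omega>))
        (Pi\<^sub>E {..<Suc n} A) = emeasure (lborel \<Otimes>\<^sub>M lborel_pow n) (A 0 \<times> Pi\<^sub>E {..<n} (\<lambda>i. A (Suc i)))"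
      by (simp add: emeasure_distr measurable_case_nat_lborel_pow box)
    also have "\<dots> = emeasure lborel (A 0) * emeasure (lborel_pow n) (Pi\<^sub>E {..<n} (\<lambda>i. A (Suc i)))"
      using A box' by (intro S.emeasure_pair_measure_Times) auto
    also have "emeasure (lborel_pow n) (Pi\<^sub>E {..<n} (\<lambda>i. A (Suc i))) = (\<Prod>i<n. emeasure lborel (A (Suc i)))"
      unfolding lborel_pow_def using A by (intro P.emeasure_PiM) auto
    also have "emeasure lborel (A 0) * (\<Prod>i<n. emeasure lborel (A (Suc i))) =
        (\<Prod>i\<in>{..<Suc n}. emeasure lborel (A i))"
      by (simp add: prod.lessThan_Suc_shift del: prod.lessThan_Suc)
    finally show "emeasure (distr (lborel \<Otimes>\<^sub>M lborel_pow n) (lborel_pow (Suc n)) (\<lambda>(a, \<omega>). case_nat a \<omega>))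
        (Pi\<^sub>E {..<Suc n} A) = (\<Prod>i\<in>{..<Suc n}. emeasure lborel (A i))" .
  qed (simp_all add: lborel_pow_def)
  then show ?thesis
    by (simp add: lborel_pow_def)
qed

lemma nn_integral_lborel_pow_Suc:
  assumes "f \<in> borel_measurable (lborel_pow (Suc n))"
  shows "(\<integral>\<^sup>+\<omega>. f \<omega> \<partial>lborel_pow (Suc n)) = (\<integral>\<^sup>+a. \<integral>\<^sup>+\<omega>. f (case_nat a \<omega>) \<partial>lborel_pow n \<partial>lborel)"
proof -
  interpret S: sigma_finite_measure "lborel_pow n" by (rule sigma_finite_lborel_pow)
  have "(\<lambda>p. f (case p of (a, \<omega>) \<Rightarrow> case_nat a \<omega>)) \<in> borel_measurable (lborel \<Otimes>\<^sub>M lborel_pow n)"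
    by (rule measurable_compose[OF measurable_case_nat_lborel_pow assms])
  then have "(\<integral>\<^sup>+a. \<integral>\<^sup>+\<omega>. f (case_nat a \<omega>) \<partial>lborel_pow n \<partial>lborel) =
      (\<integral>\<^sup>+p. f (case p of (a, \<omega>) \<Rightarrow> case_nat a \<omega>) \<partial>(lborel \<Otimes>\<^sub>M lborel_pow n))"
    by (subst S.nn_integral_fst[symmetric]) simp_all
  also have "\<dots> = (\<integral>\<^sup>+\<omega>. f \<omega> \<partial>distr (lborel \<Otimes>\<^sub>M lborel_pow n) (lborel_pow (Suc n)) (\<lambda>(a, \<omega>). case_nat a \<omega>))"
    by (rule nn_integral_distr[OF measurable_case_nat_lborel_pow, symmetric]) (simp add: assms)
  also have "\<dots> = (\<integral>\<^sup>+\<omega>. f \<omega> \<partial>lborel_pow (Suc n))"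
    by (simp flip: lborel_pow_Suc)
  finally show ?thesis ..
qed

lemma integral_lborel_pow_Suc:
  fixes f :: "(nat \<Rightarrow> real) \<Rightarrow> complex"
  assumes "integrable (lborel_pow (Suc n)) f"
  shows "(\<integral>\<omega>. f \<omega> \<partial>lborel_pow (Suc n)) = (\<integral>a. \<integral>\<omega>. f (case_nat a \<omega>) \<partial>lborel_pow n \<partial>lborel)"
    and "integrable lborel (\<lambda>a. \<integral>\<omega>. f (case_nat a \<omega>) \<partial>lborel_pow n)"
proof -
  interpret S: sigma_finite_measure "lborel_pow n" by (rule sigma_finite_lborel_pow)
  interpret pair_sigma_finite lborel "lborel_pow n" ..
  have f: "f \<in> borel_measurable (lborel_pow (Suc n))"
    using assms by simp
  have int: "integrable (lborel \<Otimes>\<^sub>M lborel_pow n) (\<lambda>p. f (case p of (a, \<omega>) \<Rightarrow> case_nat a \<omega>))"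
    using assms by (subst (asm) lborel_pow_Suc)
      (simp add: integrable_distr_eq measurable_case_nat_lborel_pow f)
  show "(\<integral>\<omega>. f \<omega> \<partial>lborel_pow (Suc n)) = (\<integral>a. \<integral>\<omega>. f (case_nat a \<omega>) \<partial>lborel_pow n \<partial>lborel)"
    using integral_fst'[OF int] f
    by (subst lborel_pow_Suc) (simp add: integral_distr measurable_case_nat_lborel_pow)
  show "integrable lborel (\<lambda>a. \<integral>\<omega>. f (case_nat a \<omega>) \<partial>lborel_pow n)"
    using integrable_fst'[OF int] by simp
qed

text \<open>
  A variable lower limit \<open>s\<close> makes the integrals recursive in the first letter, the one at which
  \<open>shuffle_list\<close> branches.
\<close>

fun iterated_kernel :: "real \<Rightarrow> (real \<Rightarrow> complex) list \<Rightarrow> real \<Rightarrow> (nat \<Rightarrow> real) \<Rightarrow> complex" where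
  "iterated_kernel x [] s \<omega> = 1"
| "iterated_kernel x (f # fs) s \<omega> =
     (if s < \<omega> 0 \<and> \<omega> 0 < x then f (\<omega> 0) * iterated_kernel x fs (\<omega> 0) (\<lambda>i. \<omega> (Suc i)) else 0)"

text \<open>In an increasing chain the bound by \<open>s\<close> is needed for the first coordinate
  only; the others inherit it. For \<open>s = 0\<close> the condition is exactly membership in
  \<open>open_simplex\<close>, which links the recursion to the given integrals.\<close>

lemma iterated_kernel_eq:
  "iterated_kernel x fs s \<omega> =
     (if (\<forall>i<length fs. s < \<omega> i \<and> \<omega> i < x) \<and> (\<forall>i j. i < j \<and> j < length fs \<longrightarrow> \<omega> i < \<omega> j)
      then \<Prod>i<length fs. (fs ! i) (\<omega> i) else 0)"
proof (induction fs arbitrary: s \<omega>)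
  case (Cons f fs)
  let ?n = "length fs"
  have "((\<forall>i<Suc ?n. s < \<omega> i \<and> \<omega> i < x) \<and> (\<forall>i j. i < j \<and> j < Suc ?n \<longrightarrow> \<omega> i < \<omega> j)) \<longleftrightarrow>
      (s < \<omega> 0 \<and> \<omega> 0 < x) \<and> (\<forall>i<?n. \<omega> 0 < \<omega> (Suc i) \<and> \<omega> (Suc i) < x) \<and>
      (\<forall>i j. i < j \<and> j < ?n \<longrightarrow> \<omega> (Suc i) < \<omega> (Suc j))" (is "?L \<longleftrightarrow> ?R")
  proof
    assume R: ?R
    have "\<omega> i < \<omega> j" if "i < j" "j < Suc ?n" for i j
      using that R by (cases i; cases j) auto
    moreover have "s < \<omega> i \<and> \<omega> i < x" if "i < Suc ?n" for i
      using that R by (cases i) (auto intro: less_trans)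
    ultimately show ?L by blast
  qed auto
  then show ?case
    unfolding length_Cons iterated_kernel.simps Cons.IH
    by (auto simp: prod.lessThan_Suc_shift simp del: prod.lessThan_Suc)
qed simp

definition iterated :: "real \<Rightarrow> (real \<Rightarrow> complex) list \<Rightarrow> real \<Rightarrow> complex" where
  "iterated x fs s = (\<integral>\<omega>. iterated_kernel x fs s \<omega> \<partial>lborel_pow (length fs))"

definition iterated_norm :: "real \<Rightarrow> (real \<Rightarrow> complex) list \<Rightarrow> real \<Rightarrow> ennreal" where
  "iterated_norm x fs s = (\<integral>\<^sup>+\<omega>. norm (iterated_kernel x fs s \<omega>) \<partial>lborel_pow (length fs))"

lemma emeasure_lborel_pow_0: "emeasure (lborel_pow 0) (space (lborel_pow 0)) = 1"
  by (simp add: lborel_pow_def PiM_empty)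

lemma iterated_Nil [simp]: "iterated x [] s = 1"
  by (simp add: iterated_def measure_def emeasure_lborel_pow_0)

lemma iterated_norm_Nil [simp]: "iterated_norm x [] s = 1"
  by (simp add: iterated_norm_def emeasure_lborel_pow_0)

text \<open>Joint measurability is needed for two reasons: the recursion feeds the coordinate
  \<omega> 0 into the tail as its lower limit, and the integral of the tail must be measurable in
  that limit to serve as an integrand for the next letter.\<close>

lemma measurable_iterated_kernel_pair:
  assumes "set fs \<subseteq> borel_measurable borel"
  shows "(\<lambda>(s, \<omega>). iterated_kernel x fs s \<omega>) \<in> borel_measurable (borel \<Otimes>\<^sub>M lborel_pow (length fs))"
  using assms
proof (induction fs)
  case (Cons f fs)
  let ?n = "length fs"
  let ?M = "borel \<Otimes>\<^sub>M lborel_pow (Suc ?n) :: (real \<times> (nat \<Rightarrow> real)) measure"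
  have [measurable]: "f \<in> borel_measurable borel"
    using Cons by simp
  have comp[measurable]: "(\<lambda>p. snd p 0) \<in> borel_measurable ?M"
    unfolding lborel_pow_def by (rule measurable_compose[OF measurable_snd]) measurable
  have "(\<lambda>\<omega>. \<lambda>i. \<omega> (Suc i)) \<in> lborel_pow (Suc ?n) \<rightarrow>\<^sub>M PiM {..<?n} (\<lambda>_. lborel)"
  proof (rule measurable_PiM_single')
    show "(\<lambda>\<omega>. \<omega> (Suc i)) \<in> lborel_pow (Suc ?n) \<rightarrow>\<^sub>M lborel" if "i \<in> {..<?n}" for i
      using that unfolding lborel_pow_def by (intro measurable_component_singleton) auto
    show "(\<lambda>\<omega> i. \<omega> (Suc i)) \<in> space (lborel_pow (Suc ?n)) \<rightarrow> (\<Pi>\<^sub>E i\<in>{..<?n}. space lborel)"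
      by (auto simp: space_lborel_pow PiE_iff extensional_def)
  qed
  then have "(\<lambda>p. (\<lambda>i. snd p (Suc i))) \<in> ?M \<rightarrow>\<^sub>M lborel_pow ?n"
    unfolding lborel_pow_def[of ?n, symmetric] by (rule measurable_compose[OF measurable_snd])
  with comp have "(\<lambda>p. (snd p 0, \<lambda>i. snd p (Suc i))) \<in> ?M \<rightarrow>\<^sub>M borel \<Otimes>\<^sub>M lborel_pow ?n"
    by measurable
  from measurable_compose[OF this Cons.IH] Cons.prems
  have [measurable]: "(\<lambda>p. iterated_kernel x fs (snd p 0) (\<lambda>i. snd p (Suc i))) \<in> borel_measurable ?M"
    by simp
  show ?case
    by (simp add: case_prod_beta')
qed (simp add: case_prod_beta')

lemma measurable_iterated_kernel:
  assumes "set fs \<subseteq> borel_measurable borel"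
  shows "iterated_kernel x fs s \<in> borel_measurable (lborel_pow (length fs))"
  using measurable_compose[OF measurable_Pair1' measurable_iterated_kernel_pair[OF assms]] by simp

lemma measurable_iterated [measurable (raw)]:
  assumes "set fs \<subseteq> borel_measurable borel"
  shows "iterated x fs \<in> borel_measurable borel"
proof -
  interpret sigma_finite_measure "lborel_pow (length fs)" by (rule sigma_finite_lborel_pow)
  show ?thesis unfolding iterated_def
    by (rule borel_measurable_lebesgue_integral[OF measurable_iterated_kernel_pair[OF assms]])
qed

lemma measurable_iterated_norm [measurable (raw)]:
  assumes "set fs \<subseteq> borel_measurable borel"
  shows "iterated_norm x fs \<in> borel_measurable borel"
proof -
  interpret sigma_finite_measure "lborel_pow (length fs)" by (rule sigma_finite_lborel_pow)
  show ?thesis unfolding iterated_norm_def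
    using measurable_iterated_kernel_pair[OF assms, of x]
    by (intro borel_measurable_nn_integral) (simp add: case_prod_beta')
qed

lemma integrable_iterated_kernel_iff:
  assumes "set fs \<subseteq> borel_measurable borel"
  shows "integrable (lborel_pow (length fs)) (iterated_kernel x fs s) \<longleftrightarrow> iterated_norm x fs s < \<infinity>"
  using measurable_iterated_kernel[OF assms] by (simp add: integrable_iff_bounded iterated_norm_def)

lemma iterated_norm_Cons:
  assumes "set (f # fs) \<subseteq> borel_measurable borel"
  shows "iterated_norm x (f # fs) s =
    (\<integral>\<^sup>+t. (if s < t \<and> t < x then ennreal (norm (f t)) * iterated_norm x fs t else 0) \<partial>lborel)"
proof -
  have "iterated_norm x (f # fs) s =
      (\<integral>\<^sup>+t. \<integral>\<^sup>+\<omega>. norm (iterated_kernel x (f # fs) s (case_nat t \<omega>)) \<partial>lborel_pow (length fs) \<partial>lborel)"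
    unfolding iterated_norm_def using measurable_iterated_kernel[OF assms, of x s]
    unfolding length_Cons
    by (intro nn_integral_lborel_pow_Suc) (simp del: iterated_kernel.simps)
  also have "\<dots> = (\<integral>\<^sup>+t. (if s < t \<and> t < x then ennreal (norm (f t)) * iterated_norm x fs t else 0) \<partial>lborel)"
  proof (rule nn_integral_cong)
    fix t
    show "(\<integral>\<^sup>+\<omega>. norm (iterated_kernel x (f # fs) s (case_nat t \<omega>)) \<partial>lborel_pow (length fs)) =
        (if s < t \<and> t < x then ennreal (norm (f t)) * iterated_norm x fs t else 0)"
      using assms measurable_iterated_kernel[of fs x]
      by (cases "s < t \<and> t < x") (auto simp: iterated_norm_def norm_mult ennreal_mult nn_integral_cmult)
  qed
  finally show ?thesis .
qed

lemma iterated_Cons: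
  assumes "set (f # fs) \<subseteq> borel_measurable borel" and "iterated_norm x (f # fs) s < \<infinity>"
  shows "iterated x (f # fs) s = (\<integral>t. (if s < t \<and> t < x then f t * iterated x fs t else 0) \<partial>lborel)"
    and "integrable lborel (\<lambda>t. if s < t \<and> t < x then f t * iterated x fs t else 0)"
proof -
  \<comment> \<open>This holds for every t. Where the inner integral diverges, both sides take the
    default value 0, whether or not f t vanishes.\<close>
  have eq: "(\<lambda>t. \<integral>\<omega>. iterated_kernel x (f # fs) s (case_nat t \<omega>) \<partial>lborel_pow (length fs)) =
      (\<lambda>t. if s < t \<and> t < x then f t * iterated x fs t else 0)"
  proof
    fix t show "(\<integral>\<omega>. iterated_kernel x (f # fs) s (case_nat t \<omega>) \<partial>lborel_pow (length fs)) =
        (if s < t \<and> t < x then f t * iterated x fs t else 0)"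
      by (cases "s < t \<and> t < x") (auto simp: iterated_def)
  qed
  have int: "integrable (lborel_pow (Suc (length fs))) (iterated_kernel x (f # fs) s)"
    using integrable_iterated_kernel_iff[OF assms(1), of x s] assms(2) by simp
  show "iterated x (f # fs) s = (\<integral>t. (if s < t \<and> t < x then f t * iterated x fs t else 0) \<partial>lborel)"
    using integral_lborel_pow_Suc(1)[OF int] unfolding eq by (simp add: iterated_def)
  show "integrable lborel (\<lambda>t. if s < t \<and> t < x then f t * iterated x fs t else 0)"
    using integral_lborel_pow_Suc(2)[OF int] unfolding eq .
qed

section \<open>The shuffle product formula\<close>

text \<open>The square over (s, x) is cut along its diagonal, a null set. In each triangle the
  smaller variable is made the outer one, so that the inner integral is an integral with lower limit
  \<open>t\<close>. This is the analytic counterpart of the branching in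
  \<open>shuffle_list\<close>.\<close>

lemma nn_integral_triangle_split:
  fixes a b :: "real \<Rightarrow> ennreal"
  assumes [measurable]: "a \<in> borel_measurable borel" "b \<in> borel_measurable borel"
  shows "(\<integral>\<^sup>+t. (if s < t \<and> t < x then a t else 0) \<partial>lborel) * (\<integral>\<^sup>+t. (if s < t \<and> t < x then b t else 0) \<partial>lborel) =
    (\<integral>\<^sup>+t. (if s < t \<and> t < x then a t * (\<integral>\<^sup>+u. (if t < u \<and> u < x then b u else 0) \<partial>lborel) else 0) \<partial>lborel) +
    (\<integral>\<^sup>+t. (if s < t \<and> t < x then b t * (\<integral>\<^sup>+u. (if t < u \<and> u < x then a u else 0) \<partial>lborel) else 0) \<partial>lborel)"
proof -
  define a' where "a' t = (if s < t \<and> t < x then a t else 0)" for t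
  define b' where "b' t = (if s < t \<and> t < x then b t else 0)" for t
  have [measurable]: "a' \<in> borel_measurable borel" "b' \<in> borel_measurable borel"
    unfolding a'_def b'_def by measurable
  have "(\<integral>\<^sup>+t. a' t \<partial>lborel) * (\<integral>\<^sup>+t. b' t \<partial>lborel) = (\<integral>\<^sup>+t. \<integral>\<^sup>+u. a' t * b' u \<partial>lborel \<partial>lborel)"
    by (simp add: nn_integral_cmult nn_integral_multc)
  also have "\<dots> = (\<integral>\<^sup>+t. \<integral>\<^sup>+u. (if t < u then a' t * b' u else 0) + (if u < t then a' t * b' u else 0) \<partial>lborel \<partial>lborel)"
    by (rule nn_integral_cong, rule nn_integral_cong_AE, rule eventually_mono[OF AE_lborel_singleton]) auto
  also have "\<dots> = (\<integral>\<^sup>+t. \<integral>\<^sup>+u. (if t < u then a' t * b' u else 0) \<partial>lborel \<partial>lborel) +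
      (\<integral>\<^sup>+t. \<integral>\<^sup>+u. (if u < t then a' t * b' u else 0) \<partial>lborel \<partial>lborel)"
    by (simp add: nn_integral_add)
  \<comment> \<open>Here the inner variable is the smaller one, so the order is exchanged.\<close>
  also have "(\<integral>\<^sup>+t. \<integral>\<^sup>+u. (if u < t then a' t * b' u else 0) \<partial>lborel \<partial>lborel) =
      (\<integral>\<^sup>+u. \<integral>\<^sup>+t. (if u < t then a' t * b' u else 0) \<partial>lborel \<partial>lborel)"
    by (rule lborel_pair.Fubini') measurable
  also have "\<dots> = (\<integral>\<^sup>+t. (if s < t \<and> t < x then b t * (\<integral>\<^sup>+u. (if t < u \<and> u < x then a u else 0) \<partial>lborel) else 0) \<partial>lborel)"
    unfolding a'_def b'_def
    by (intro nn_integral_cong) (auto simp: nn_integral_cmult[symmetric] mult.commute intro!: nn_integral_cong cong: if_cong)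
  also have "(\<integral>\<^sup>+t. \<integral>\<^sup>+u. (if t < u then a' t * b' u else 0) \<partial>lborel \<partial>lborel) =
      (\<integral>\<^sup>+t. (if s < t \<and> t < x then a t * (\<integral>\<^sup>+u. (if t < u \<and> u < x then b u else 0) \<partial>lborel) else 0) \<partial>lborel)"
    unfolding a'_def b'_def
    by (intro nn_integral_cong) (auto simp: nn_integral_cmult[symmetric] intro!: nn_integral_cong cong: if_cong)
  finally show ?thesis
    unfolding a'_def b'_def .
qed

text \<open>The same cut for complex integrands. The product of the two functions is integrable over
  the plane and dominates its restriction to either triangle, which justifies additivity and the
  exchange of order.\<close>

lemma integral_triangle_split:
  fixes a b :: "real \<Rightarrow> complex"
  assumes a: "integrable lborel (\<lambda>t. if s < t \<and> t < x then a t else 0)"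
    and b: "integrable lborel (\<lambda>t. if s < t \<and> t < x then b t else 0)"
  shows "(\<integral>t. (if s < t \<and> t < x then a t else 0) \<partial>lborel) * (\<integral>t. (if s < t \<and> t < x then b t else 0) \<partial>lborel) =
    (\<integral>t. (if s < t \<and> t < x then a t * (\<integral>u. (if t < u \<and> u < x then b u else 0) \<partial>lborel) else 0) \<partial>lborel) +
    (\<integral>t. (if s < t \<and> t < x then b t * (\<integral>u. (if t < u \<and> u < x then a u else 0) \<partial>lborel) else 0) \<partial>lborel)"
proof -
  define a' where "a' t = (if s < t \<and> t < x then a t else 0)" for t
  define b' where "b' t = (if s < t \<and> t < x then b t else 0)" for t
  have int: "integrable lborel a'" "integrable lborel b'"
    using a b unfolding a'_def b'_def .
  have [measurable]: "a' \<in> borel_measurable borel" "b' \<in> borel_measurable borel"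
    using int[THEN borel_measurable_integrable] by simp_all
  have ab: "integrable (lborel \<Otimes>\<^sub>M lborel) (\<lambda>p. a' (fst p) * b' (snd p))"
    using int by (intro lborel_pair.Fubini_integrable) (auto simp: norm_mult)
  have lower: "integrable (lborel \<Otimes>\<^sub>M lborel) (\<lambda>(t, u). if t < u then a' t * b' u else 0)"
    by (rule Bochner_Integration.integrable_bound[OF ab]) (auto simp: case_prod_beta')
  have upper: "integrable (lborel \<Otimes>\<^sub>M lborel) (\<lambda>(t, u). if u < t then a' t * b' u else 0)"
    by (rule Bochner_Integration.integrable_bound[OF ab]) (auto simp: case_prod_beta')
  have "(\<integral>t. a' t \<partial>lborel) * (\<integral>t. b' t \<partial>lborel) = (\<integral>t. \<integral>u. a' t * b' u \<partial>lborel \<partial>lborel)"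
    by simp
  also have "\<dots> = (\<integral>t. (\<integral>u. (if t < u then a' t * b' u else 0) \<partial>lborel) + (\<integral>u. (if u < t then a' t * b' u else 0) \<partial>lborel) \<partial>lborel)"
  proof (rule Bochner_Integration.integral_cong[OF refl])
    fix t
    have ind: "integrable lborel (\<lambda>u. if P u then a' t * b' u else 0)" if [measurable]: "Measurable.pred borel P" for P
      by (rule Bochner_Integration.integrable_bound[of _ "\<lambda>u. a' t * b' u"]) (use int in auto)
    have "(\<integral>u. a' t * b' u \<partial>lborel) =
        (\<integral>u. (if t < u then a' t * b' u else 0) + (if u < t then a' t * b' u else 0) \<partial>lborel)"
      by (intro integral_cong_AE eventually_mono[OF AE_lborel_singleton[of t]]) auto
    also have "\<dots> = (\<integral>u. (if t < u then a' t * b' u else 0) \<partial>lborel) + (\<integral>u. (if u < t then a' t * b' u else 0) \<partial>lborel)"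
      by (intro Bochner_Integration.integral_add ind) measurable
    finally show "(\<integral>u. a' t * b' u \<partial>lborel) =
      (\<integral>u. (if t < u then a' t * b' u else 0) \<partial>lborel) + (\<integral>u. (if u < t then a' t * b' u else 0) \<partial>lborel)" .
  qed
  also have "\<dots> = (\<integral>t. \<integral>u. (if t < u then a' t * b' u else 0) \<partial>lborel \<partial>lborel) +
      (\<integral>t. \<integral>u. (if u < t then a' t * b' u else 0) \<partial>lborel \<partial>lborel)"
    by (intro Bochner_Integration.integral_add lborel_pair.integrable_fst lower upper)
  also have "(\<integral>t. \<integral>u. (if u < t then a' t * b' u else 0) \<partial>lborel \<partial>lborel) =
      (\<integral>u. \<integral>t. (if u < t then a' t * b' u else 0) \<partial>lborel \<partial>lborel)"
    by (rule lborel_pair.Fubini_integral[OF upper, symmetric])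
  also have "\<dots> = (\<integral>t. (if s < t \<and> t < x then b t * (\<integral>u. (if t < u \<and> u < x then a u else 0) \<partial>lborel) else 0) \<partial>lborel)"
    unfolding a'_def b'_def
    by (intro Bochner_Integration.integral_cong refl)
      (auto simp: mult.commute intro!: Bochner_Integration.integral_cong cong: if_cong simp flip: integral_mult_right_zero)
  also have "(\<integral>t. \<integral>u. (if t < u then a' t * b' u else 0) \<partial>lborel \<partial>lborel) =
      (\<integral>t. (if s < t \<and> t < x then a t * (\<integral>u. (if t < u \<and> u < x then b u else 0) \<partial>lborel) else 0) \<partial>lborel)"
    unfolding a'_def b'_def
    by (intro Bochner_Integration.integral_cong refl)
      (auto intro!: Bochner_Integration.integral_cong cong: if_cong simp flip: integral_mult_right_zero)
  finally show ?thesis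
    unfolding a'_def b'_def .
qed

section \<open>Induction over the shuffles of two words\<close>

lemma sum_list_iterated_norm_Cons:
  assumes "f \<in> borel_measurable borel" and "\<And>w. w \<in> set ws \<Longrightarrow> set w \<subseteq> borel_measurable borel"
  shows "(\<integral>\<^sup>+t. (if s < t \<and> t < x then ennreal (norm (f t)) * sum_list (map (\<lambda>w. iterated_norm x w t) ws) else 0) \<partial>lborel) =
    sum_list (map (\<lambda>w. iterated_norm x (f # w) s) ws)"
  using assms(2)
proof (induction ws)
  case (Cons w ws)
  note [measurable] = assms(1)
  have [measurable]: "iterated_norm x w \<in> borel_measurable borel"
    "(\<lambda>t. sum_list (map (\<lambda>w. iterated_norm x w t) ws)) \<in> borel_measurable borel"
  proof -
    show "iterated_norm x w \<in> borel_measurable borel"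
      using Cons.prems by (intro measurable_iterated_norm) auto
    show "(\<lambda>t. sum_list (map (\<lambda>w. iterated_norm x w t) ws)) \<in> borel_measurable borel"
      using Cons.prems by (induction ws) (auto intro!: borel_measurable_add measurable_iterated_norm)
  qed
  have "(\<integral>\<^sup>+t. (if s < t \<and> t < x then ennreal (norm (f t)) * sum_list (map (\<lambda>w. iterated_norm x w t) (w # ws)) else 0) \<partial>lborel) =
      (\<integral>\<^sup>+t. (if s < t \<and> t < x then ennreal (norm (f t)) * iterated_norm x w t else 0) +
        (if s < t \<and> t < x then ennreal (norm (f t)) * sum_list (map (\<lambda>w. iterated_norm x w t) ws) else 0) \<partial>lborel)"
    by (intro nn_integral_cong) (auto simp: distrib_left)
  also have "\<dots> = iterated_norm x (f # w) s + sum_list (map (\<lambda>w. iterated_norm x (f # w) s) ws)"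
    using Cons assms(1) by (subst nn_integral_add) (auto simp: iterated_norm_Cons)
  finally show ?case by simp
qed (simp cong: if_cong)

lemma sum_list_iterated_Cons:
  assumes "f \<in> borel_measurable borel" and "\<And>w. w \<in> set ws \<Longrightarrow> set w \<subseteq> borel_measurable borel"
    and "\<And>w. w \<in> set ws \<Longrightarrow> iterated_norm x (f # w) s < \<infinity>"
  shows "(\<integral>t. (if s < t \<and> t < x then f t * sum_list (map (\<lambda>w. iterated x w t) ws) else 0) \<partial>lborel) =
      sum_list (map (\<lambda>w. iterated x (f # w) s) ws)"
    and "integrable lborel (\<lambda>t. if s < t \<and> t < x then f t * sum_list (map (\<lambda>w. iterated x w t) ws) else 0)"
proof -
  \<comment> \<open>Both claims go through one induction because additivity of the integral needs
    integrability of the remaining sum.\<close>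
  have "(\<integral>t. (if s < t \<and> t < x then f t * sum_list (map (\<lambda>w. iterated x w t) ws) else 0) \<partial>lborel) =
      sum_list (map (\<lambda>w. iterated x (f # w) s) ws) \<and>
    integrable lborel (\<lambda>t. if s < t \<and> t < x then f t * sum_list (map (\<lambda>w. iterated x w t) ws) else 0)"
    using assms(2,3)
  proof (induction ws)
    case (Cons w ws)
    have w: "set (f # w) \<subseteq> borel_measurable borel" "iterated_norm x (f # w) s < \<infinity>"
      using Cons.prems assms(1) by auto
    have "(\<lambda>t. if s < t \<and> t < x then f t * sum_list (map (\<lambda>w. iterated x w t) (w # ws)) else 0) =
        (\<lambda>t. (if s < t \<and> t < x then f t * iterated x w t else 0) +
          (if s < t \<and> t < x then f t * sum_list (map (\<lambda>w. iterated x w t) ws) else 0))"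
      by (auto simp: distrib_left)
    with Cons iterated_Cons[OF w] show ?case
      by simp
  qed (simp cong: if_cong)
  then show "(\<integral>t. (if s < t \<and> t < x then f t * sum_list (map (\<lambda>w. iterated x w t) ws) else 0) \<partial>lborel) =
      sum_list (map (\<lambda>w. iterated x (f # w) s) ws)"
    and "integrable lborel (\<lambda>t. if s < t \<and> t < x then f t * sum_list (map (\<lambda>w. iterated x w t) ws) else 0)"
    by blast+
qed

text \<open>Tonelli's theorem suffices here, so infinite values are allowed. If both factors are
  finite, every summand on the right is finite as well; this is how convergence reaches the
  shuffles.\<close>

lemma iterated_norm_mult_shuffle:
  assumes "set u \<subseteq> borel_measurable borel" "set v \<subseteq> borel_measurable borel"
  shows "iterated_norm x u s * iterated_norm x v s =
    sum_list (map (\<lambda>w. iterated_norm x w s) (shuffle_list u v))"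
  using assms
proof (induction u v arbitrary: s rule: shuffle_list.induct)
  case (3 f u g v)
  have f[measurable]: "f \<in> borel_measurable borel" and g[measurable]: "g \<in> borel_measurable borel"
    using 3 by auto
  have [measurable]: "iterated_norm x u \<in> borel_measurable borel" "iterated_norm x v \<in> borel_measurable borel"
    using 3 by (auto intro!: measurable_iterated_norm)
  have sub: "set u \<subseteq> borel_measurable borel" "set v \<subseteq> borel_measurable borel"
    using "3.prems" by auto
  have m: "w \<in> set (shuffle_list u (g # v)) \<Longrightarrow> set w \<subseteq> borel_measurable borel"
    "w \<in> set (shuffle_list (f # u) v) \<Longrightarrow> set w \<subseteq> borel_measurable borel" for w
    using "3.prems" set_shuffle_list by fastforce+
  have "iterated_norm x (f # u) s * iterated_norm x (g # v) s =
      (\<integral>\<^sup>+t. (if s < t \<and> t < x then ennreal (norm (f t)) * iterated_norm x u t * iterated_norm x (g # v) t else 0) \<partial>lborel) +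
      (\<integral>\<^sup>+t. (if s < t \<and> t < x then ennreal (norm (g t)) * iterated_norm x v t * iterated_norm x (f # u) t else 0) \<partial>lborel)"
    unfolding iterated_norm_Cons[OF "3.prems"(1)] iterated_norm_Cons[OF "3.prems"(2)]
    by (rule nn_integral_triangle_split) measurable
  also have "\<dots> =
      (\<integral>\<^sup>+t. (if s < t \<and> t < x then ennreal (norm (f t)) * (iterated_norm x u t * iterated_norm x (g # v) t) else 0) \<partial>lborel) +
      (\<integral>\<^sup>+t. (if s < t \<and> t < x then ennreal (norm (g t)) * (iterated_norm x (f # u) t * iterated_norm x v t) else 0) \<partial>lborel)"
    by (simp only: mult.assoc mult.commute[of "iterated_norm x v t" for t])
  also have "\<dots> = sum_list (map (\<lambda>w. iterated_norm x (f # w) s) (shuffle_list u (g # v))) +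
      sum_list (map (\<lambda>w. iterated_norm x (g # w) s) (shuffle_list (f # u) v))"
    using "3.prems" unfolding "3.IH"(1)[OF sub(1) "3.prems"(2)] "3.IH"(2)[OF "3.prems"(1) sub(2)]
    by (intro arg_cong2[where f = "(+)"] sum_list_iterated_norm_Cons f g m)
  finally show ?case
    by (simp add: comp_def)
qed auto

text \<open>Raising the lower limit shrinks the domain. Hence a word that converges from
  \<open>s\<close> converges from every later \<open>t\<close>, which keeps the unbranched word
  under control in the induction.\<close>

lemma iterated_norm_Cons_antimono:
  assumes "set (f # fs) \<subseteq> borel_measurable borel" "s \<le> t"
  shows "iterated_norm x (f # fs) t \<le> iterated_norm x (f # fs) s"
  unfolding iterated_norm_Cons[OF assms(1)] using assms(2) by (intro nn_integral_mono) auto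

text \<open>A nonnegative function with finite integral is finite almost everywhere. The alternative
  \<open>f t = 0\<close> has to stay because 0 times \<infinity> is 0: the tail may diverge where
  the first factor vanishes.\<close>

lemma AE_iterated_norm_finite:
  assumes "set (f # fs) \<subseteq> borel_measurable borel" "iterated_norm x (f # fs) s < \<infinity>"
  shows "AE t in lborel. s < t \<and> t < x \<longrightarrow> f t = 0 \<or> iterated_norm x fs t < \<infinity>"
proof -
  have [measurable]: "f \<in> borel_measurable borel" "iterated_norm x fs \<in> borel_measurable borel"
    using assms(1) by (auto intro!: measurable_iterated_norm)
  have "AE t in lborel. (if s < t \<and> t < x then ennreal (norm (f t)) * iterated_norm x fs t else 0) \<noteq> \<infinity>"
    using assms(2) unfolding iterated_norm_Cons[OF assms(1)]
    by (intro nn_integral_PInf_AE) auto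
  then show ?thesis
    by eventually_elim (auto simp: ennreal_mult_eq_top_iff simp flip: less_top)
qed

lemma iterated_mult_shuffle:
  assumes "set u \<subseteq> borel_measurable borel" "set v \<subseteq> borel_measurable borel"
    and "iterated_norm x u s < \<infinity>" "iterated_norm x v s < \<infinity>"
  shows "iterated x u s * iterated x v s = sum_list (map (\<lambda>w. iterated x w s) (shuffle_list u v))"
  using assms
proof (induction u v arbitrary: s rule: shuffle_list.induct)
  case (3 f u g v)
  note prems = "3.prems"
  have f[measurable]: "f \<in> borel_measurable borel" and g[measurable]: "g \<in> borel_measurable borel"
    using prems by auto
  have [measurable]: "iterated x u \<in> borel_measurable borel" "iterated x v \<in> borel_measurable borel"
    "iterated x (f # u) \<in> borel_measurable borel" "iterated x (g # v) \<in> borel_measurable borel"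
    using prems by (auto intro!: measurable_iterated)
  have m: "w \<in> set (shuffle_list u (g # v)) \<Longrightarrow> set w \<subseteq> borel_measurable borel"
    "w \<in> set (shuffle_list (f # u) v) \<Longrightarrow> set w \<subseteq> borel_measurable borel" for w
    using prems set_shuffle_list by fastforce+
  \<comment> \<open>The product of the two finite norms is this sum, and each summand is bounded by
    it.\<close>
  have "sum_list (map (\<lambda>w. iterated_norm x w s) (shuffle_list (f # u) (g # v))) < \<infinity>"
    using prems by (simp only: iterated_norm_mult_shuffle[symmetric]) (simp add: ennreal_mult_less_top)
  moreover have "iterated_norm x w s \<le> sum_list (map (\<lambda>w. iterated_norm x w s) ws)" if "w \<in> set ws" for w ws
    using that by (intro member_le_sum_list) auto
  ultimately have fin: "iterated_norm x w s < \<infinity>" if "w \<in> set (shuffle_list (f # u) (g # v))" for w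
    using that le_less_trans by blast
  text \<open>At points where \<open>f t = 0\<close> the inner integral may diverge; elsewhere it converges almost everywhere.\<close>
  have IH1: "AE t in lborel. s < t \<and> t < x \<longrightarrow> f t * (iterated x u t * iterated x (g # v) t) =
      f t * sum_list (map (\<lambda>w. iterated x w t) (shuffle_list u (g # v)))"
    using AE_iterated_norm_finite[OF prems(1,3)]
  proof eventually_elim
    case (elim t)
    show ?case
    proof (intro impI, cases "f t = 0")
      assume t: "s < t \<and> t < x" and "f t \<noteq> 0"
      then have "iterated_norm x (g # v) t < \<infinity>" "iterated_norm x u t < \<infinity>"
        using iterated_norm_Cons_antimono[OF prems(2), of s t x] prems(4) elim by auto
      then show "f t * (iterated x u t * iterated x (g # v) t) =
          f t * sum_list (map (\<lambda>w. iterated x w t) (shuffle_list u (g # v)))"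
        using prems by (subst "3.IH"(1)) auto
    qed simp
  qed
  have IH2: "AE t in lborel. s < t \<and> t < x \<longrightarrow> g t * (iterated x (f # u) t * iterated x v t) =
      g t * sum_list (map (\<lambda>w. iterated x w t) (shuffle_list (f # u) v))"
    using AE_iterated_norm_finite[OF prems(2,4)]
  proof eventually_elim
    case (elim t)
    show ?case
    proof (intro impI, cases "g t = 0")
      assume t: "s < t \<and> t < x" and "g t \<noteq> 0"
      then have "iterated_norm x (f # u) t < \<infinity>" "iterated_norm x v t < \<infinity>"
        using iterated_norm_Cons_antimono[OF prems(1), of s t x] prems(3) elim by auto
      then show "g t * (iterated x (f # u) t * iterated x v t) =
          g t * sum_list (map (\<lambda>w. iterated x w t) (shuffle_list (f # u) v))"
        using prems by (subst "3.IH"(2)) auto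
    qed simp
  qed
  have shuf: "w \<in> set (shuffle_list u (g # v)) \<Longrightarrow> iterated_norm x (f # w) s < \<infinity>"
    "w \<in> set (shuffle_list (f # u) v) \<Longrightarrow> iterated_norm x (g # w) s < \<infinity>" for w
    by (rule fin; simp)+
  note sums1 = sum_list_iterated_Cons[OF f m(1) shuf(1)]
  note sums2 = sum_list_iterated_Cons[OF g m(2) shuf(2)]
  \<comment> \<open>Unlike the tails, the full words converge from every t > s, so the inner
    integrals can be replaced pointwise.\<close>
  have inner_f: "(\<integral>u'. (if t < u' \<and> u' < x then f u' * iterated x u u' else 0) \<partial>lborel) = iterated x (f # u) t"
    if "s < t" for t
    using that iterated_norm_Cons_antimono[OF prems(1), of s t x] prems(3)
    by (intro iterated_Cons(1)[OF prems(1), symmetric]) auto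
  have inner_g: "(\<integral>u'. (if t < u' \<and> u' < x then g u' * iterated x v u' else 0) \<partial>lborel) = iterated x (g # v) t"
    if "s < t" for t
    using that iterated_norm_Cons_antimono[OF prems(2), of s t x] prems(4)
    by (intro iterated_Cons(1)[OF prems(2), symmetric]) auto
  have "iterated x (f # u) s * iterated x (g # v) s =
      (\<integral>t. (if s < t \<and> t < x then f t * iterated x u t * (\<integral>u. (if t < u \<and> u < x then g u * iterated x v u else 0) \<partial>lborel) else 0) \<partial>lborel) +
      (\<integral>t. (if s < t \<and> t < x then g t * iterated x v t * (\<integral>w. (if t < w \<and> w < x then f w * iterated x u w else 0) \<partial>lborel) else 0) \<partial>lborel)"
    unfolding iterated_Cons(1)[OF prems(1,3)] iterated_Cons(1)[OF prems(2,4)]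
    by (rule integral_triangle_split[OF iterated_Cons(2)[OF prems(1,3)] iterated_Cons(2)[OF prems(2,4)]])
  also have "(\<integral>t. (if s < t \<and> t < x then f t * iterated x u t * (\<integral>u. (if t < u \<and> u < x then g u * iterated x v u else 0) \<partial>lborel) else 0) \<partial>lborel) =
      (\<integral>t. (if s < t \<and> t < x then f t * (iterated x u t * iterated x (g # v) t) else 0) \<partial>lborel)"
    by (intro Bochner_Integration.integral_cong refl) (simp only: inner_g mult.assoc cong: if_cong)
  also have "\<dots> = (\<integral>t. (if s < t \<and> t < x then f t * sum_list (map (\<lambda>w. iterated x w t) (shuffle_list u (g # v))) else 0) \<partial>lborel)"
    by (intro integral_cong_AE eventually_mono[OF IH1]) (use sums1(2) in \<open>auto dest: borel_measurable_integrable\<close>)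
  also have "\<dots> = sum_list (map (\<lambda>w. iterated x (f # w) s) (shuffle_list u (g # v)))"
    by (rule sums1(1))
  also have "(\<integral>t. (if s < t \<and> t < x then g t * iterated x v t * (\<integral>w. (if t < w \<and> w < x then f w * iterated x u w else 0) \<partial>lborel) else 0) \<partial>lborel) =
      (\<integral>t. (if s < t \<and> t < x then g t * (iterated x (f # u) t * iterated x v t) else 0) \<partial>lborel)"
    by (intro Bochner_Integration.integral_cong refl)
      (simp only: inner_f mult.assoc mult.commute[of "iterated x v t" for t] cong: if_cong)
  also have "\<dots> = (\<integral>t. (if s < t \<and> t < x then g t * sum_list (map (\<lambda>w. iterated x w t) (shuffle_list (f # u) v)) else 0) \<partial>lborel)"
    by (intro integral_cong_AE eventually_mono[OF IH2]) (use sums2(2) in \<open>auto dest: borel_measurable_integrable\<close>)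
  also have "\<dots> = sum_list (map (\<lambda>w. iterated x (g # w) s) (shuffle_list (f # u) v))"
    by (rule sums2(1))
  finally show ?case
    by (simp add: comp_def)
qed auto

section \<open>From meromorphic functions to measurable integrands on the line\<close>

text \<open>The kernel with lower limit 0 sees only arguments in (0, x). Cutting off elsewhere
  yields a function measurable on the whole line, although \<open>f\<close> is arbitrary outside
  \<open>D\<close>.\<close>

definition real_restriction :: "real \<Rightarrow> (complex \<Rightarrow> complex) \<Rightarrow> real \<Rightarrow> complex" where
  "real_restriction x f t = (if 0 < t \<and> t < x then f (complex_of_real t) else 0)"

text \<open>The points where \<open>f\<close> is not analytic are sparse, hence finitely many on the
  compact segment. Away from them the restriction to (0, x) is continuous, and changing a function
  on a finite set preserves Borel measurability.\<close>

lemma measurable_real_restriction: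
  assumes mero: "f meromorphic_on D" and D: "complex_of_real ` {0..x} \<subseteq> D"
  shows "real_restriction x f \<in> borel_measurable borel"
proof -
  define X where "X = {t \<in> {0..x}. \<not> f analytic_on {complex_of_real t}}"
  have "{w \<in> complex_of_real ` {0..x}. \<not> f analytic_on {w}} sparse_in complex_of_real ` {0..x}"
    by (rule meromorphic_on_imp_sparse_singularities'[OF meromorphic_on_subset[OF mero D]])
  moreover have "compact (complex_of_real ` {0..x})"
    by (intro compact_continuous_image continuous_on_of_real continuous_on_id compact_Icc)
  ultimately have "finite (complex_of_real ` {0..x} \<inter> {w \<in> complex_of_real ` {0..x}. \<not> f analytic_on {w}})"
    by (rule sparse_in_compact_finite)
  moreover have "complex_of_real ` X \<subseteq>
      complex_of_real ` {0..x} \<inter> {w \<in> complex_of_real ` {0..x}. \<not> f analytic_on {w}}"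
    by (auto simp: X_def)
  ultimately have "finite (complex_of_real ` X)"
    by (rule finite_subset[rotated])
  then have "finite X"
    by (rule finite_imageD) (simp add: inj_on_def)
  have "continuous_on ({0<..<x} - X) (\<lambda>t. f (complex_of_real t))"
  proof (intro continuous_at_imp_continuous_on ballI)
    fix t assume "t \<in> {0<..<x} - X"
    then have "f analytic_on {complex_of_real t}"
      by (auto simp: X_def)
    then have "isCont f (complex_of_real t)"
      by (rule analytic_at_imp_isCont)
    then show "isCont (\<lambda>t. f (complex_of_real t)) t"
      by (rule isCont_o2[OF continuous_of_real[OF continuous_ident]])
  qed
  moreover have "{0<..<x} - X \<in> sets borel"
    using \<open>finite X\<close> by (intro sets.Diff borel_open borel_closed finite_imp_closed open_greaterThanLessThan)
  ultimately have "(\<lambda>t. indicator ({0<..<x} - X) t *\<^sub>R f (complex_of_real t)) \<in> borel_measurable borel"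
    by (rule borel_measurable_continuous_on_indicator[rotated])
  then show ?thesis
  proof (rule measurable_discrete_difference)
    show "countable X"
      using \<open>finite X\<close> by (rule countable_finite)
    show "indicator ({0<..<x} - X) t *\<^sub>R f (complex_of_real t) = real_restriction x f t"
      if "t \<in> space borel" "t \<notin> X" for t
      using that by (simp add: real_restriction_def)
  qed simp_all
qed

lemma iterated_kernel_real_restriction:
  assumes "t \<in> space (lborel_pow (length fs))"
  shows "iterated_kernel x (map (real_restriction x) fs) 0 t =
    indicator (open_simplex (length fs) x) t *\<^sub>R iterated_integrand fs t"
  using assms
  by (auto simp: iterated_kernel_eq open_simplex_def iterated_integrand_def indicator_def
      real_restriction_def intro!: prod.cong)

lemma iterated_integral_eq_iterated:
  "iterated_integral fs x = iterated x (map (real_restriction x) fs) 0"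
  unfolding iterated_integral_def iterated_def set_lebesgue_integral_def length_map
  by (intro Bochner_Integration.integral_cong refl) (rule iterated_kernel_real_restriction[symmetric])

lemma iterated_integral_converges_iff:
  assumes "\<And>f. f \<in> set fs \<Longrightarrow> real_restriction x f \<in> borel_measurable borel"
  shows "iterated_integral_converges fs x \<longleftrightarrow> iterated_norm x (map (real_restriction x) fs) 0 < \<infinity>"
proof -
  have "iterated_integral_converges fs x \<longleftrightarrow>
      integrable (lborel_pow (length fs)) (iterated_kernel x (map (real_restriction x) fs) 0)"
    unfolding iterated_integral_converges_def set_integrable_def
    by (intro Bochner_Integration.integrable_cong refl) (rule iterated_kernel_real_restriction[symmetric])
  also have "\<dots> \<longleftrightarrow> iterated_norm x (map (real_restriction x) fs) 0 < \<infinity>"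
    using integrable_iterated_kernel_iff[of "map (real_restriction x) fs" x 0] assms by auto
  finally show ?thesis .
qed

text \<open>True even if \<open>h\<close> identifies letters, since multiplicities are kept. This
  matters because \<open>real_restriction x\<close> need not be injective.\<close>

lemma shuffle_list_map: "shuffle_list (map h u) (map h v) = map (map h) (shuffle_list u v)"
  by (induction u v rule: shuffle_list.induct) simp_all

lemma iterated_integral_mult_shuffle:
  assumes "\<And>f. f \<in> set u \<union> set v \<Longrightarrow> real_restriction x f \<in> borel_measurable borel"
    and "iterated_integral_converges u x" "iterated_integral_converges v x"
  shows "iterated_integral u x * iterated_integral v x =
    sum_list (map (\<lambda>w. iterated_integral w x) (shuffle_list u v))"
proof -
  let ?h = "map (real_restriction x)"
  have "iterated x (?h u) 0 * iterated x (?h v) 0 =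
      sum_list (map (\<lambda>w. iterated x w 0) (shuffle_list (?h u) (?h v)))"
    using assms iterated_integral_converges_iff[of u x] iterated_integral_converges_iff[of v x]
    by (intro iterated_mult_shuffle) auto
  then show ?thesis
    by (simp add: iterated_integral_eq_iterated shuffle_list_map comp_def)
qed

section \<open>The two identities\<close>

text \<open>The suffix \<open>v\<close> is left open to serve twice: a power of \<open>z0\<close>
  gives the first identity, and the empty word gives the relation among the integrals of powers of
  \<open>z\<close> that drives the inversion.\<close>

lemma alternating_iterated_integral_sum:
  assumes "n \<ge> 1"
    and "\<And>f. f \<in> insert z (set v) \<Longrightarrow> real_restriction x f \<in> borel_measurable borel"
    and "\<And>j. j \<in> {1..n} \<Longrightarrow> iterated_integral_converges (replicate (n - j) z) x"
    and "\<And>j. j \<in> {1..n} \<Longrightarrow> iterated_integral_converges (replicate j z @ v) x"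
  shows "(\<Sum>j=1..n. (-1) ^ (j - 1) * iterated_integral (replicate (n - j) z) x *
             iterated_integral (replicate j z @ v) x) =
    sum_list (map (\<lambda>w. iterated_integral (z # w) x) (shuffle_list (replicate (n - 1) z) v))"
proof -
  have "(\<Sum>j=1..n. (-1) ^ (j - 1) * iterated_integral (replicate (n - j) z) x *
             iterated_integral (replicate j z @ v) x) =
      (\<Sum>j=1..n. (-1) ^ (j - 1) * sum_list (map (\<lambda>w. iterated_integral w x)
        (shuffle_list (replicate (n - j) z) (replicate j z @ v))))"
  proof (intro sum.cong refl)
    fix j assume j: "j \<in> {1..n}"
    have "iterated_integral (replicate (n - j) z) x * iterated_integral (replicate j z @ v) x =
        sum_list (map (\<lambda>w. iterated_integral w x) (shuffle_list (replicate (n - j) z) (replicate j z @ v)))"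
    proof (rule iterated_integral_mult_shuffle[OF _ assms(3,4)[OF j]])
      show "real_restriction x f \<in> borel_measurable borel"
        if "f \<in> set (replicate (n - j) z) \<union> set (replicate j z @ v)" for f
        by (rule assms(2)) (use that in \<open>auto split: if_splits\<close>)
    qed
    then show "(-1) ^ (j - 1) * iterated_integral (replicate (n - j) z) x *
        iterated_integral (replicate j z @ v) x = (-1) ^ (j - 1) *
        sum_list (map (\<lambda>w. iterated_integral w x) (shuffle_list (replicate (n - j) z) (replicate j z @ v)))"
      by (simp add: mult.assoc)
  qed
  moreover have "Suc (n - 1) = n"
    using \<open>n \<ge> 1\<close> by simp
  ultimately show ?thesis
    using alternating_shuffle_sum[of "\<lambda>w. iterated_integral w x" "n - 1" z v] by (simp only:)
qed

theorem theorem3p1: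
  fixes k r :: nat and z z0 :: "complex \<Rightarrow> complex" and D :: "complex set" and x :: real
  assumes "k \<ge> 1" and "r \<ge> 1" and "x > 0"
    and "open D" and "complex_of_real ` {0..x} \<subseteq> D"
    and "at_most_log_singularities_on z D" and "at_most_log_singularities_on z0 D"
    and "\<And>j. j \<in> {1..r} \<Longrightarrow>
           formal_polylog_converges z0 (replicate (r - j) z) (replicate (r - j) 1) x"
    and "\<And>j. j \<in> {1..r} \<Longrightarrow>
           formal_polylog_converges z0 (replicate j z) (replicate (j - 1) 1 @ [k]) x"
    and "\<And>j ks. j \<in> {1..r} \<Longrightarrow> ks \<in> compositions j (k + j - 1) \<Longrightarrow>
           formal_polylog_converges z0 (replicate j z) ks x"
  shows "(\<Sum>ks\<in>compositions r (k + r - 1). formal_polylog z0 (replicate r z) ks x) =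
           (\<Sum>j=1..r. (-1) ^ (j - 1)
              * formal_polylog z0 (replicate (r - j) z) (replicate (r - j) 1) x
              * formal_polylog z0 (replicate j z) (replicate (j - 1) 1 @ [k]) x)
       \<and> formal_polylog z0 (replicate r z) (replicate (r - 1) 1 @ [k]) x =
           (\<Sum>j=1..r. (-1) ^ (j - 1)
              * formal_polylog z0 (replicate (r - j) z) (replicate (r - j) 1) x
              * (\<Sum>ks\<in>compositions j (k + j - 1). formal_polylog z0 (replicate j z) ks x))"
proof -
  define F where "F n = formal_polylog z0 (replicate n z) (replicate n 1) x" for n
  define T where "T n = formal_polylog z0 (replicate n z) (replicate (n - 1) 1 @ [k]) x" for n
  define S where "S n = (\<Sum>ks\<in>compositions n (k + n - 1). formal_polylog z0 (replicate n z) ks x)" for n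
  have F: "F n = iterated_integral (replicate n z) x" for n
    unfolding F_def formal_polylog_def polylog_word_ones ..
  have T: "T n = iterated_integral (replicate n z @ replicate (k - 1) z0) x" if "n \<ge> 1" for n
    unfolding T_def formal_polylog_def polylog_word_ones_snoc[OF that] ..
  have meas: "real_restriction x f \<in> borel_measurable borel" if "f \<in> {z, z0}" for f
    using that assms(5-7) by (auto simp: at_most_log_singularities_on_def intro!: measurable_real_restriction)
  have convF: "iterated_integral_converges (replicate n z) x" if "n < r" for n
    using assms(8)[of "r - n"] that
    by (simp add: formal_polylog_converges_def polylog_word_ones[unfolded One_nat_def])
  have convT: "iterated_integral_converges (replicate n z @ replicate (k - 1) z0) x" if "1 \<le> n" "n \<le> r" for n
    using assms(9)[of n] that unfolding formal_polylog_converges_def polylog_word_ones_snoc[OF that(1)] by simp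
  have S: "S n = (\<Sum>j=1..n. (-1) ^ (j - 1) * F (n - j) * T j)" if n: "1 \<le> n" "n \<le> r" for n
  proof -
    have "(\<Sum>j=1..n. (-1) ^ (j - 1) * F (n - j) * T j) =
        (\<Sum>j=1..n. (-1) ^ (j - 1) * iterated_integral (replicate (n - j) z) x *
          iterated_integral (replicate j z @ replicate (k - 1) z0) x)"
      by (intro sum.cong refl) (simp add: F T)
    also have "\<dots> = sum_list (map (\<lambda>w. iterated_integral (z # w) x)
        (shuffle_list (replicate (n - 1) z) (replicate (k - 1) z0)))"
    proof (rule alternating_iterated_integral_sum)
      show "iterated_integral_converges (replicate (n - j) z) x" if "j \<in> {1..n}" for j
        by (rule convF) (use that n in auto)
      show "iterated_integral_converges (replicate j z @ replicate (k - 1) z0) x" if "j \<in> {1..n}" for j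
        by (rule convT) (use that n in auto)
      show "real_restriction x f \<in> borel_measurable borel" if "f \<in> insert z (set (replicate (k - 1) z0))" for f
        by (rule meas) (use that in \<open>auto split: if_splits\<close>)
    qed (rule n)
    \<comment> \<open>As n and k are at least 1, these are the compositions of k + n - 1 into n
      parts.\<close>
    also have "\<dots> = (\<Sum>ks\<in>compositions (Suc (n - 1)) (Suc (n - 1) + (k - 1)).
        iterated_integral (polylog_word z0 (replicate (Suc (n - 1)) z) ks) x)"
      by (rule sum_compositions_polylog_word[symmetric])
    also have "\<dots> = S n"
      using n \<open>k \<ge> 1\<close> by (simp add: S_def formal_polylog_def add.commute)
    finally show ?thesis ..
  qed
  \<comment> \<open>With an empty suffix the only shuffle is the word itself, so the alternating sum
    collapses to \<open>F n\<close>. All words involved are z^j with j \<le> n < r, within the range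
    of \<open>convF\<close>.\<close>
  have FF: "F n = (\<Sum>j=1..n. (-1) ^ (j - 1) * F (n - j) * F j)" if "1 \<le> n" "n < r" for n
  proof -
    have "(\<Sum>j=1..n. (-1) ^ (j - 1) * iterated_integral (replicate (n - j) z) x *
          iterated_integral (replicate j z @ []) x) =
        sum_list (map (\<lambda>w. iterated_integral (z # w) x) (shuffle_list (replicate (n - 1) z) []))"
    proof (rule alternating_iterated_integral_sum)
      show "iterated_integral_converges (replicate (n - j) z) x" if "j \<in> {1..n}" for j
        by (rule convF) (use that \<open>n < r\<close> in auto)
      show "iterated_integral_converges (replicate j z @ []) x" if "j \<in> {1..n}" for j
        unfolding append_Nil2 by (rule convF) (use that \<open>n < r\<close> in auto)
      show "real_restriction x f \<in> borel_measurable borel" if "f \<in> insert z (set [])" for f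
        by (rule meas) (use that in simp)
    qed (rule \<open>1 \<le> n\<close>)
    moreover have "z # replicate (n - 1) z = replicate n z"
      using \<open>1 \<le> n\<close> by (cases n) simp_all
    ultimately show ?thesis
      by (simp add: F)
  qed
  have "T r = (\<Sum>j=1..r. (-1) ^ (j - 1) * F (r - j) * S j)"
    by (rule alternating_convolution_inversion[OF \<open>r \<ge> 1\<close> _ FF S]) (simp_all add: F iterated_integral_Nil)
  then show ?thesis
    using S[OF \<open>r \<ge> 1\<close> order.refl] unfolding F_def T_def S_def by blast
qed

end
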